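(* Let $d\ge1$, $0<c_j<1$ for $j\in D=\{1,\dots,d\}$, let $\mathbf{X}_0$ and $\mathbf{Y}_n=(Y_{n,1},\dots,Y_{n,d})$, $n\ge1$, be independent random vectors in $\mathbb{R}^d$ with $\mathbf{Y}_n\sim G$ for all $n$, and let $X_{n,j}=\max(c_jX_{n-1,j},\,Y_{n,j})$ for $n\ge1$, $j\in D$. Suppose $\{\mathbf{X}_n=(X_{n,1},\dots,X_{n,d})\}$ is stationary with common distribution function $F$ having continuous margins $F_1,\dots,F_d$. Let $j,j'\in D$ and $r\in\mathbb{N}_0$. Then $$\lambda_{jj'}^{(r)}(\mathbf{X})=2-\lim_{t\downarrow0}\frac1t\left(1-C_{jj'}\big(1-t,F_{j'}(c_{j'}^{-r}w_{j't})\big)\frac{1-t}{F_{j'}(c_{j'}^{-r}w_{j't})}\right),$$ where $C_{jj'}$ denotes the common copula of $(X_{n,j},X_{n,j'})$, $n\ge1$, and $w_{j't}=F_{j'}^{-1}(1-t)$. Moreover, for $t\in(0,1)$, $$1-\frac{1-t}{F_{j'}(c_{j'}^{-r}w_{j't})}\le 2-\frac1t\left(1-C_{jj'}\big(1-t,F_{j'}(c_{j'}^{-r}w_{j't})\big)\frac{1-t}{F_{j'}(c_{j'}^{-r}w_{j't})}\right)\le 2-\frac1t\left(1-\frac{(1-t)^2}{F_{j'}(c_{j'}^{-r}w_{j't})}\right).$$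
   Context: The lag-$r$ tail dependence coefficient is $\lambda_{jj'}^{(r)}(\mathbf{X})=\lim_{t\downarrow0}P\big(F_{j'}(X_{1+r,j'})>1-t\,\big|\,F_j(X_{1,j})>1-t\big)$ (when the limit exists). $F_{j'}^{-1}$ is the generalized inverse $F_{j'}^{-1}(u)=\inf\{y:F_{j'}(y)\ge u\}$. $C_{jj'}(u,v)=P(F_j(X_{n,j})\le u,\,F_{j'}(X_{n,j'})\le v)$. *)

theory Defs
  imports "HOL-Probability.Probability"
begin

text \<open>
  Random vectors in \<open>\<real>\<^sup>d\<close> take values in \<open>real ^ 'd\<close>, with the finite (hence nonempty) type \<open>'d\<close>
  in the role of \<open>D = {1,\<dots>,d}\<close>.
\<close>

definition joint_cdf :: "'a measure \<Rightarrow> ('a \<Rightarrow> real ^ 'd) \<Rightarrow> real ^ 'd \<Rightarrow> real" where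
  "joint_cdf M V x = \<P>(\<omega> in M. \<forall>i. V \<omega> $ i \<le> x $ i)"

text \<open>The \<open>i\<close>-th margin is \<open>F\<^sub>i(x) = F(\<infinity>,\<dots>,x,\<dots>,\<infinity>)\<close>; see \<open>margin_joint_cdf\<close> below.\<close>

definition margin :: "(real ^ 'd \<Rightarrow> real) \<Rightarrow> 'd \<Rightarrow> real \<Rightarrow> real" where
  "margin F i x = Lim at_top (\<lambda>s. F (\<chi> k. if k = i then x else s))"

definition strictly_stationary :: "'a measure \<Rightarrow> 'b measure \<Rightarrow> (nat \<Rightarrow> 'a \<Rightarrow> 'b) \<Rightarrow> bool" where
  "strictly_stationary M N Z \<longleftrightarrow>
     (\<forall>J h. finite J \<longrightarrow>
        distr M (Pi\<^sub>M J (\<lambda>_. N)) (\<lambda>\<omega>. \<lambda>k\<in>J. Z (k + h) \<omega>) =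
        distr M (Pi\<^sub>M J (\<lambda>_. N)) (\<lambda>\<omega>. \<lambda>k\<in>J. Z k \<omega>))"

text \<open>Only used for arguments in \<open>(0,1)\<close>, where the set below is nonempty and bounded below
  whenever \<open>H\<close> is a distribution function.\<close>

definition gen_inverse :: "(real \<Rightarrow> real) \<Rightarrow> real \<Rightarrow> real" where
  "gen_inverse H u = Inf {y. H y \<ge> u}"

definition pair_copula ::
  "'a measure \<Rightarrow> (real ^ 'd \<Rightarrow> real) \<Rightarrow> ('a \<Rightarrow> real ^ 'd) \<Rightarrow> 'd \<Rightarrow> 'd \<Rightarrow> real \<Rightarrow> real \<Rightarrow> real" where
  "pair_copula M F V j j' u v =
     \<P>(\<omega> in M. margin F j (V \<omega> $ j) \<le> u \<and> margin F j' (V \<omega> $ j') \<le> v)"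

definition tail_cond_prob ::
  "'a measure \<Rightarrow> (real ^ 'd \<Rightarrow> real) \<Rightarrow> (nat \<Rightarrow> 'a \<Rightarrow> real ^ 'd) \<Rightarrow> nat \<Rightarrow> 'd \<Rightarrow> 'd \<Rightarrow> real \<Rightarrow> real" where
  "tail_cond_prob M F X r j j' t =
     \<P>(\<omega> in M. margin F j' (X (1 + r) \<omega> $ j') > 1 - t \<bar> margin F j (X 1 \<omega> $ j) > 1 - t)"

definition lag_tail_dep_exists ::
  "'a measure \<Rightarrow> (real ^ 'd \<Rightarrow> real) \<Rightarrow> (nat \<Rightarrow> 'a \<Rightarrow> real ^ 'd) \<Rightarrow> nat \<Rightarrow> 'd \<Rightarrow> 'd \<Rightarrow> bool" where
  "lag_tail_dep_exists M F X r j j' \<longleftrightarrow>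
     (\<exists>l. (tail_cond_prob M F X r j j' \<longlongrightarrow> l) (at_right 0))"

text \<open>Meaningful only under \<open>lag_tail_dep_exists\<close>.\<close>

definition lag_tail_dep ::
  "'a measure \<Rightarrow> (real ^ 'd \<Rightarrow> real) \<Rightarrow> (nat \<Rightarrow> 'a \<Rightarrow> real ^ 'd) \<Rightarrow> nat \<Rightarrow> 'd \<Rightarrow> 'd \<Rightarrow> real" where
  "lag_tail_dep M F X r j j' = Lim (at_right 0) (tail_cond_prob M F X r j j')"

lemma margin_joint_cdf:
  fixes V :: "'a \<Rightarrow> real ^ 'd"
  assumes "prob_space M" and V: "V \<in> borel_measurable M"
  shows "margin (joint_cdf M V) i x = cdf (distr M borel (\<lambda>\<omega>. V \<omega> $ i)) x"
proof -
  interpret prob_space M by fact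
  have Vi [measurable]: "(\<lambda>\<omega>. V \<omega> $ k) \<in> borel_measurable M" for k
    using V by (rule measurable_compose) (intro borel_measurable_continuous_onI continuous_on_component continuous_on_id)
  define A where "A s = {\<omega> \<in> space M. \<forall>k. V \<omega> $ k \<le> (if k = i then x else s)}" for s :: real
  have A [measurable]: "A s \<in> sets M" for s
    unfolding A_def by measurable
  have mono: "A s \<subseteq> A s'" if "s \<le> s'" for s s'
  proof
    fix \<omega> assume w: "\<omega> \<in> A s"
    have "V \<omega> $ k \<le> (if k = i then x else s')" for k
    proof -
      have "V \<omega> $ k \<le> (if k = i then x else s)" using w unfolding A_def by blast
      then show ?thesis using that by (cases "k = i") simp_all
    qed
    then show "\<omega> \<in> A s'" using w unfolding A_def by blast
  qed
  have un: "(\<Union>n. A (real n)) = {\<omega> \<in> space M. V \<omega> $ i \<le> x}"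
  proof (intro subset_antisym subsetI)
    fix \<omega> assume w: "\<omega> \<in> {\<omega> \<in> space M. V \<omega> $ i \<le> x}"
    obtain n :: nat where n: "Max (range (\<lambda>k. V \<omega> $ k)) \<le> real n"
      using real_arch_simple by blast
    have "V \<omega> $ k \<le> real n" for k
      using n Max_ge[of "range (\<lambda>k. V \<omega> $ k)" "V \<omega> $ k"] by simp
    then show "\<omega> \<in> (\<Union>n. A (real n))" using w by (auto simp: A_def)
  next
    fix \<omega> assume "\<omega> \<in> (\<Union>n. A (real n))"
    then obtain n where "\<omega> \<in> A (real n)" by blast
    then have sp: "\<omega> \<in> space M" and le: "\<forall>k. V \<omega> $ k \<le> (if k = i then x else real n)"
      unfolding A_def by blast+
    from le have "V \<omega> $ i \<le> (if i = i then x else real n)" ..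
    with sp show "\<omega> \<in> {\<omega> \<in> space M. V \<omega> $ i \<le> x}" by simp
  qed
  have "(\<lambda>n. prob (A (real n))) \<longlonglongrightarrow> prob (\<Union>n. A (real n))"
  proof (rule finite_Lim_measure_incseq)
    show "incseq (\<lambda>n. A (real n))" by (simp add: incseq_def mono)
    show "range (\<lambda>n. A (real n)) \<subseteq> sets M" using A by blast
  qed
  then have "((\<lambda>s. prob (A s)) \<longlongrightarrow> prob {\<omega> \<in> space M. V \<omega> $ i \<le> x}) at_top"
    unfolding un
    by (intro tendsto_at_topI_sequentially_real) (simp_all add: mono_def finite_measure_mono mono)
  moreover have "joint_cdf M V (\<chi> k. if k = i then x else s) = prob (A s)" for s
    by (simp add: joint_cdf_def A_def)
  ultimately have "margin (joint_cdf M V) i x = prob {\<omega> \<in> space M. V \<omega> $ i \<le> x}"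
    unfolding margin_def by (simp add: tendsto_Lim)
  also have "\<dots> = cdf (distr M borel (\<lambda>\<omega>. V \<omega> $ i)) x"
    by (simp add: cdf_def measure_distr vimage_def Int_def conj_commute)
  finally show ?thesis .
qed

end

theory Submission
  imports Defs
begin

text \<open>
  Fix \<open>t\<close> in \<open>(0,1)\<close>. The limit formula comes from an identity that already holds for each such \<open>t\<close>:
  the conditional probability equals \<open>2 - L t\<close>. To see this, pass to complements. By inclusion and
  exclusion the joint exceedance probability is \<open>1 - 2 (1 - t) + p\<close>, where \<open>p\<close> is the probability
  that \<open>F\<^sub>j(X\<^sub>1\<^sub>,\<^sub>j) \<le> 1 - t\<close> and \<open>F\<^sub>j\<^sub>'(X\<^sub>1\<^sub>+\<^sub>r\<^sub>,\<^sub>j\<^sub>') \<le> 1 - t\<close>, and the conditioning event has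
  probability \<open>t\<close>; so everything rests on computing \<open>p\<close>.

  Up to a null set the second event is \<open>X\<^sub>1\<^sub>+\<^sub>r\<^sub>,\<^sub>j\<^sub>' \<le> w\<close> with \<open>w\<close> the \<open>(1 - t)\<close>-quantile
  (\<open>cdf_gen_inverse\<close>, \<open>AE_cdf_le_cdf_iff\<close>). Unrolling the recursion, a maximum is at most \<open>w\<close> iff all
  its terms are, so this event says that \<open>X\<^sub>1\<^sub>,\<^sub>j\<^sub>' \<le> c\<^sub>j\<^sub>'\<close>\<open>\<^sup>-\<^sup>r w\<close> and that the discounted innovations
  \<open>Y\<^sub>2, \<dots>, Y\<^sub>1\<^sub>+\<^sub>r\<close> stay below \<open>w\<close>. The latter are independent of \<open>X\<^sub>1\<close>, hence contribute a factor
  \<open>H\<close> (\<open>prob_max_autoregression_split\<close>). The first part contributes the copula value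
  \<open>C(1 - t, q t)\<close>. The factor \<open>H\<close> is found by using the same factorisation without any condition
  on \<open>X\<^sub>1\<close>: stationarity turns it into \<open>1 - t = q t \<cdot> H\<close>. Therefore
  \<open>p = C(1 - t, q t) (1 - t) / q t\<close>.

  The two bounds are the Frechet bound \<open>C(u,v) \<ge> u + v - 1\<close> and the trivial bound \<open>C(u,v) \<le> u\<close>
  inserted into \<open>L\<close>.
\<close>

section \<open>Continuous distribution functions\<close>

context prob_space
begin

lemma cdf_distr_eq_prob:
  fixes U :: "'a \<Rightarrow> real"
  assumes "random_variable borel U"
  shows "cdf (distr M borel U) y = \<P>(\<omega> in M. U \<omega> \<le> y)"
  using assms by (simp add: cdf_def measure_distr vimage_def Int_def conj_commute)

text \<open>The probability integral transform, at the levels \<open>H y\<close>. By continuity \<open>{z. H z \<le> H y}\<close> is a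
  closed down-set. If it is a half-line \<open>{..s}\<close>, then \<open>y \<le> s\<close> forces \<open>H s = H y\<close>; if it is the whole
  line, then \<open>H y\<close> dominates the limit \<open>1\<close> of \<open>H\<close>.\<close>

lemma prob_cdf_le_cdf:
  fixes U :: "'a \<Rightarrow> real"
  assumes U: "random_variable borel U"
    and cont: "continuous_on UNIV (cdf (distr M borel U))"
  defines "H \<equiv> cdf (distr M borel U)"
  shows "\<P>(\<omega> in M. H (U \<omega>) \<le> H y) = H y"
proof -
  interpret D: real_distribution "distr M borel U"
    using U by simp
  define S where "S = {z. H z \<le> H y}"
  show ?thesis
  proof (cases "bdd_above S")
    case True
    have "closed S"
      unfolding S_def using cont by (intro closed_Collect_le) (simp_all add: H_def)
    moreover have "y \<in> S" by (simp add: S_def)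
    ultimately have sup: "Sup S \<in> S"
      using True by (intro closed_contains_Sup) auto
    have le: "H (Sup S) \<le> H y" using sup by (simp add: S_def)
    have "y \<le> Sup S" using \<open>y \<in> S\<close> True by (rule cSup_upper)
    then have ge: "H y \<le> H (Sup S)" unfolding H_def by (rule D.cdf_nondecreasing)
    have "H z \<le> H y \<longleftrightarrow> z \<le> Sup S" for z
    proof
      assume "H z \<le> H y"
      then show "z \<le> Sup S" using True by (intro cSup_upper) (simp_all add: S_def)
    next
      assume "z \<le> Sup S"
      then have "H z \<le> H (Sup S)" unfolding H_def by (rule D.cdf_nondecreasing)
      with le show "H z \<le> H y" by simp
    qed
    then have "\<P>(\<omega> in M. H (U \<omega>) \<le> H y) = H (Sup S)"
      using U by (simp add: H_def cdf_distr_eq_prob)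
    with le ge show ?thesis by simp
  next
    case False
    have all: "H z \<le> H y" for z
    proof -
      obtain s where "s \<in> S" "z < s"
        using False by (meson bdd_aboveI not_less)
      then have "H z \<le> H s" "H s \<le> H y"
        unfolding H_def S_def by (auto intro: D.cdf_nondecreasing)
      then show ?thesis by simp
    qed
    have "(H \<longlongrightarrow> 1) at_top" unfolding H_def by (rule D.cdf_lim_at_top_prob)
    then have "1 \<le> H y"
      by (rule tendsto_upperbound) (simp_all add: all)
    then have "H y = 1"
      using D.cdf_bounded_prob[of y] by (simp add: H_def)
    then show ?thesis using all by (simp add: prob_space)
  qed
qed

text \<open>One event contains the other by monotonicity, and both have probability \<open>H y\<close>. On a flat
  piece of \<open>H\<close> the two inequalities genuinely differ, but only on a null set.\<close>

lemma AE_cdf_le_cdf_iff: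
  fixes U :: "'a \<Rightarrow> real"
  assumes U [measurable]: "random_variable borel U"
    and cont: "continuous_on UNIV (cdf (distr M borel U))"
  defines "H \<equiv> cdf (distr M borel U)"
  shows "AE \<omega> in M. H (U \<omega>) \<le> H y \<longleftrightarrow> U \<omega> \<le> y"
proof -
  interpret D: real_distribution "distr M borel U"
    using U by simp
  have [measurable]: "H \<in> borel_measurable borel"
    using cont unfolding H_def by (rule borel_measurable_continuous_onI)
  let ?A = "{\<omega> \<in> space M. H (U \<omega>) \<le> H y}" and ?B = "{\<omega> \<in> space M. U \<omega> \<le> y}"
  have sub: "?B \<subseteq> ?A" unfolding H_def by (auto intro: D.cdf_nondecreasing)
  have "prob (?A - ?B) = prob ?A - prob ?B"
    using sub by (intro finite_measure_Diff) measurable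
  also have "\<dots> = 0"
    using prob_cdf_le_cdf[OF U cont, of y] cdf_distr_eq_prob[OF U, of y]
    by (simp add: H_def)
  finally have "AE \<omega> in M. \<omega> \<notin> ?A - ?B"
    by (subst (asm) prob_eq_0) measurable
  then show ?thesis
    using AE_space by eventually_elim (use sub in blast)
qed

text \<open>A continuous \<open>H\<close> attains the level \<open>p\<close>, and its superlevel set is closed, so that the infimum
  in the generalized inverse is a minimum.\<close>

lemma cdf_gen_inverse:
  fixes U :: "'a \<Rightarrow> real"
  assumes U: "random_variable borel U"
    and cont: "continuous_on UNIV (cdf (distr M borel U))"
    and p: "0 < p" "p < 1"
  defines "H \<equiv> cdf (distr M borel U)"
  shows "H (gen_inverse H p) = p"
proof -
  interpret D: real_distribution "distr M borel U"
    using U by simp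
  let ?S = "{y. p \<le> H y}"
  have "eventually (\<lambda>y. H y < p) at_bot"
    using order_tendstoD(2)[OF D.cdf_lim_at_bot p(1)] by (simp add: H_def)
  then obtain a where a: "H a < p" by (auto simp: eventually_at_bot_linorder)
  have "eventually (\<lambda>y. p < H y) at_top"
    using order_tendstoD(1)[OF D.cdf_lim_at_top_prob p(2)] by (simp add: H_def)
  then obtain b where b: "p < H b" by (auto simp: eventually_at_top_linorder)
  have mono: "H x \<le> H y" if "x \<le> y" for x y
    using that unfolding H_def by (rule D.cdf_nondecreasing)
  have "a \<le> b" using mono[of b a] a b by linarith
  then obtain y where y: "H y = p"
    using IVT'[of H a p b] a b cont
    by (auto simp: H_def intro: continuous_on_subset)
  have "a \<le> z" if "z \<in> ?S" for z
    using mono[of z a] a that by (cases "a \<le> z") auto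
  then have bdd: "bdd_below ?S" by (rule bdd_belowI)
  have "closed ?S"
    using cont by (intro closed_Collect_le) (simp_all add: H_def)
  then have "Inf ?S \<in> ?S"
    using y bdd by (intro closed_contains_Inf) auto
  moreover have "H (Inf ?S) \<le> H y"
    using y bdd by (intro mono cInf_lower) auto
  ultimately show ?thesis using y by (simp add: gen_inverse_def)
qed

end

section \<open>Unrolling the recursion\<close>

text \<open>Each step back in time divides the threshold by \<open>a\<close>, so the induction on \<open>r\<close> has to run over
  all thresholds. Stating the conditions with powers of \<open>a\<close> on the left avoids division.\<close>

lemma max_recursion_le_iff:
  fixes x y :: "nat \<Rightarrow> real"
  assumes "a > 0"
    and rec: "\<And>k. x (Suc k) = max (a * x k) (y (Suc k))"
  shows "x (m + r) \<le> u \<longleftrightarrow> a ^ r * x m \<le> u \<and> (\<forall>k\<in>{1..r}. a ^ (r - k) * y (m + k) \<le> u)"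
proof (induction r arbitrary: u)
  case 0
  show ?case by simp
next
  case (Suc r)
  have div: "z \<le> u / a \<longleftrightarrow> a * z \<le> u" for z
    using \<open>a > 0\<close> by (simp add: field_simps)
  have "x (m + Suc r) \<le> u \<longleftrightarrow> x (m + r) \<le> u / a \<and> y (m + Suc r) \<le> u"
    by (simp add: rec div)
  also have "\<dots> \<longleftrightarrow> a ^ Suc r * x m \<le> u \<and>
      (\<forall>k\<in>{1..r}. a ^ (Suc r - k) * y (m + k) \<le> u) \<and> y (m + Suc r) \<le> u"
    by (simp add: Suc.IH Suc_diff_le mult.assoc flip: div)
  also have "\<dots> \<longleftrightarrow> a ^ Suc r * x m \<le> u \<and>
      (\<forall>k\<in>{1..Suc r}. a ^ (Suc r - k) * y (m + k) \<le> u)"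
    by (simp add: atLeastAtMostSuc_conv conj_commute)
  finally show ?case .
qed

section \<open>Factoring out the innovations\<close>

lemma measurable_vec_nth:
  "(\<lambda>v :: real ^ 'd. v $ i) \<in> borel_measurable borel"
  by (intro borel_measurable_continuous_onI continuous_on_component continuous_on_id)

lemma measurable_vec_lambda:
  fixes f :: "'d::finite \<Rightarrow> 'b \<Rightarrow> real"
  assumes "\<And>i. f i \<in> borel_measurable N"
  shows "(\<lambda>x. \<chi> i. f i x) \<in> borel_measurable N"
  unfolding borel_measurable_euclidean_space[where 'c = "real ^ 'd"]
  using assms by (auto simp: Basis_vec_def inner_axis)

text \<open>The recursion keeps the state at time \<open>1\<close> separate from the later innovations:
  \<open>X\<^sub>1\<close> is a function of \<open>X\<^sub>0\<close> and \<open>Y\<^sub>1\<close> only, while the innovations that enter \<open>X\<^sub>1\<^sub>+\<^sub>r\<close> after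
  time \<open>1\<close> are \<open>Y\<^sub>2, \<dots>, Y\<^sub>1\<^sub>+\<^sub>r\<close>. Hence a bound on a coordinate of \<open>X\<^sub>1\<^sub>+\<^sub>r\<close> splits into a bound on
  \<open>X\<^sub>1\<close> and an independent factor that does not see the event \<open>X\<^sub>1 \<in> A\<close>.\<close>

lemma (in prob_space) prob_max_autoregression_split:
  fixes X Y :: "nat \<Rightarrow> 'a \<Rightarrow> real ^ 'd"
  assumes pos: "\<And>i. 0 < c i"
    and indep: "indep_vars (\<lambda>_. borel) (\<lambda>m. if m = 0 then X 0 else Y m) UNIV"
    and rec: "\<And>m i \<omega>. m \<ge> 1 \<Longrightarrow> \<omega> \<in> space M \<Longrightarrow>
           X m \<omega> $ i = max (c i * X (m - 1) \<omega> $ i) (Y m \<omega> $ i)"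
    and A: "A \<in> sets borel"
  shows "\<P>(\<omega> in M. X 1 \<omega> \<in> A \<and> X (1 + r) \<omega> $ i \<le> u) =
    \<P>(\<omega> in M. X 1 \<omega> \<in> A \<and> c i ^ r * X 1 \<omega> $ i \<le> u) *
    \<P>(\<omega> in M. \<forall>k\<in>{1..r}. c i ^ (r - k) * Y (1 + k) \<omega> $ i \<le> u)"
proof -
  note [measurable] = measurable_vec_nth
  define V where "V m = (if m = 0 then X 0 else Y m)" for m
  let ?P = "Pi\<^sub>M {0, 1} (\<lambda>_ :: nat. borel :: (real ^ 'd) measure)"
  let ?Q = "Pi\<^sub>M {2..1 + r} (\<lambda>_ :: nat. borel :: (real ^ 'd) measure)"
  have ind: "indep_var ?P (\<lambda>\<omega>. restrict (\<lambda>m. V m \<omega>) {0, 1}) ?Q (\<lambda>\<omega>. restrict (\<lambda>m. V m \<omega>) {2..1 + r})"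
    using indep by (intro indep_var_restrict[where I = UNIV]) (auto simp: V_def[abs_def])
  define g where "g f = (\<chi> k. max (c k * f 0 $ k) (f 1 $ k))" for f :: "nat \<Rightarrow> real ^ 'd"
  have [measurable]: "g \<in> measurable ?P borel"
    unfolding g_def by (intro measurable_vec_lambda) measurable
  define A' where "A' = {f \<in> space ?P. g f \<in> A \<and> c i ^ r * g f $ i \<le> u}"
  define B where "B = {f \<in> space ?Q. \<forall>k\<in>{1..r}. c i ^ (r - k) * f (1 + k) $ i \<le> u}"
  have A': "A' \<in> sets ?P"
    unfolding A'_def using A by measurable
  have "(\<lambda>f. f (1 + k) $ i) \<in> borel_measurable ?Q" if "k \<in> {1..r}" for k
    by (rule measurable_compose[OF _ measurable_vec_nth], rule measurable_component_singleton)
      (use that in auto)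
  then have B: "B \<in> sets ?Q"
    unfolding B_def by (intro sets.sets_Collect_finite_All) auto
  have X1: "g (restrict (\<lambda>m. V m \<omega>) {0, 1}) = X 1 \<omega>" if "\<omega> \<in> space M" for \<omega>
    using rec[of 1 \<omega>] that by (simp add: g_def V_def vec_eq_iff)
  have evA: "(\<lambda>\<omega>. restrict (\<lambda>m. V m \<omega>) {0, 1}) -` A' \<inter> space M =
      {\<omega> \<in> space M. X 1 \<omega> \<in> A \<and> c i ^ r * X 1 \<omega> $ i \<le> u}"
    using X1 by (auto simp: A'_def space_PiM)
  have evB: "(\<lambda>\<omega>. restrict (\<lambda>m. V m \<omega>) {2..1 + r}) -` B \<inter> space M =
      {\<omega> \<in> space M. \<forall>k\<in>{1..r}. c i ^ (r - k) * Y (1 + k) \<omega> $ i \<le> u}"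
    by (auto simp: B_def V_def space_PiM)
  have unroll: "X (1 + r) \<omega> $ i \<le> u \<longleftrightarrow> c i ^ r * X 1 \<omega> $ i \<le> u \<and>
      (\<forall>k\<in>{1..r}. c i ^ (r - k) * Y (1 + k) \<omega> $ i \<le> u)" if "\<omega> \<in> space M" for \<omega>
    using that rec[of "Suc _" \<omega> i] pos
    by (intro max_recursion_le_iff[where x = "\<lambda>m. X m \<omega> $ i" and y = "\<lambda>m. Y m \<omega> $ i"]) auto
  have "{\<omega> \<in> space M. X 1 \<omega> \<in> A \<and> X (1 + r) \<omega> $ i \<le> u} =
      {\<omega> \<in> space M. X 1 \<omega> \<in> A \<and> c i ^ r * X 1 \<omega> $ i \<le> u} \<inter>
      {\<omega> \<in> space M. \<forall>k\<in>{1..r}. c i ^ (r - k) * Y (1 + k) \<omega> $ i \<le> u}"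
    using unroll by blast
  also have "\<dots> = (\<lambda>\<omega>. (restrict (\<lambda>m. V m \<omega>) {0, 1}, restrict (\<lambda>m. V m \<omega>) {2..1 + r})) -` (A' \<times> B)
      \<inter> space M"
    unfolding evA[symmetric] evB[symmetric] by auto
  finally show ?thesis
    using indep_varD[OF ind A' B] unfolding evA evB by simp
qed

section \<open>The lag tail dependence coefficient\<close>

theorem proposition5p1:
  fixes M :: "'a measure"
    and X Y :: "nat \<Rightarrow> 'a \<Rightarrow> real ^ 'd"
    and c :: "'d \<Rightarrow> real"
    and F G :: "real ^ 'd \<Rightarrow> real"
    and j j' :: 'd
    and r n :: nat
  assumes "prob_space M"
    and "\<And>i. 0 < c i \<and> c i < 1"
    and "prob_space.indep_vars M (\<lambda>_. borel) (\<lambda>m. if m = 0 then X 0 else Y m) UNIV"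
    and "\<And>m. m \<ge> 1 \<Longrightarrow> joint_cdf M (Y m) = G"
    and "\<And>m i \<omega>. m \<ge> 1 \<Longrightarrow> \<omega> \<in> space M \<Longrightarrow>
           X m \<omega> $ i = max (c i * X (m - 1) \<omega> $ i) (Y m \<omega> $ i)"
    and "strictly_stationary M borel (\<lambda>m. X (m + 1))"
    and "\<And>m. m \<ge> 1 \<Longrightarrow> joint_cdf M (X m) = F"
    and "\<And>i. continuous_on UNIV (margin F i)"
    and "n \<ge> 1"
  shows "let w = (\<lambda>t. gen_inverse (margin F j') (1 - t));
             q = (\<lambda>t. margin F j' (c j' powi (- int r) * w t));
             C = pair_copula M F (X n) j j';
             L = (\<lambda>t. 1 / t * (1 - C (1 - t) (q t) * ((1 - t) / q t)))
         in (lag_tail_dep_exists M F X r j j' \<longleftrightarrow> (\<exists>l. (L \<longlongrightarrow> l) (at_right 0))) \<and>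
            (lag_tail_dep_exists M F X r j j' \<longrightarrow>
               lag_tail_dep M F X r j j' = 2 - Lim (at_right 0) L) \<and>
            (\<forall>t. 0 < t \<and> t < 1 \<longrightarrow>
               1 - (1 - t) / q t \<le> 2 - L t \<and>
               2 - L t \<le> 2 - 1 / t * (1 - (1 - t)\<^sup>2 / q t))"
proof -
  interpret prob_space M by fact
  note indep = assms(3) and rec = assms(5) and cont = assms(8)
  note [measurable] = measurable_vec_nth
  have pos: "0 < c i" for i using assms(2) by blast

  have V_meas: "random_variable borel (if m = 0 then X 0 else Y m)" for m
    using bspec[OF conjunct1[OF indep[unfolded indep_vars_def]], of m] by simp
  have X0: "random_variable borel (X 0)" and Y_meas: "random_variable borel (Y (Suc m))" for m
    using V_meas[of 0] V_meas[of "Suc m"] by simp_all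
  have X [measurable]: "random_variable borel (X m)" for m
  proof (induction m)
    case (Suc m)
    note [measurable] = Suc.IH Y_meas
    have "(\<lambda>\<omega>. \<chi> i. max (c i * X m \<omega> $ i) (Y (Suc m) \<omega> $ i)) \<in> borel_measurable M"
      by (intro measurable_vec_lambda) measurable
    moreover have "X (Suc m) \<omega> = (\<chi> i. max (c i * X m \<omega> $ i) (Y (Suc m) \<omega> $ i))"
      if "\<omega> \<in> space M" for \<omega>
      using rec[of "Suc m" \<omega>] that by (simp add: vec_eq_iff)
    ultimately show ?case by (simp cong: measurable_cong)
  qed (rule X0)
  have Xi [measurable]: "random_variable borel (\<lambda>\<omega>. X m \<omega> $ i)" for m i
    by measurable

  have margin: "margin F i = cdf (distr M borel (\<lambda>\<omega>. X m \<omega> $ i))" if "m \<ge> 1" for m i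
    unfolding assms(7)[OF that, symmetric] by (intro ext margin_joint_cdf[OF assms(1) X])
  have margin_eq: "margin F i y = \<P>(\<omega> in M. X m \<omega> $ i \<le> y)" if "m \<ge> 1" for m i y
    using cdf_distr_eq_prob[OF Xi] by (simp add: margin[OF that])
  have [measurable]: "margin F i \<in> borel_measurable borel" for i
    using cont by (rule borel_measurable_continuous_onI)
  have AE_le: "AE \<omega> in M. margin F i (X m \<omega> $ i) \<le> margin F i y \<longleftrightarrow> X m \<omega> $ i \<le> y"
    if "m \<ge> 1" for m i y
    using AE_cdf_le_cdf_iff[OF Xi, of m i y] cont[of i] by (simp add: margin[OF that])
  have marg_inv: "margin F i (gen_inverse (margin F i) p) = p" if "0 < p" "p < 1" for i p
    using cdf_gen_inverse[OF Xi, of 1 i p] cont[of i] that by (simp add: margin[of 1])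
  have unif: "\<P>(\<omega> in M. margin F i (X m \<omega> $ i) \<le> p) = p" if "m \<ge> 1" "0 < p" "p < 1" for i m p
    using prob_cdf_le_cdf[OF Xi, of m i "gen_inverse (margin F i) p"] cont[of i]
      marg_inv[OF that(2,3), of i]
    by (simp add: margin[OF that(1), symmetric])

  define w where "w t = gen_inverse (margin F j') (1 - t)" for t
  define q where "q t = margin F j' (c j' powi (- int r) * w t)" for t
  define C where "C = pair_copula M F (X n) j j'"
  define L where "L t = 1 / t * (1 - C (1 - t) (q t) * ((1 - t) / q t))" for t

  have distr_n: "distr M borel (X n) = distr M borel (X 1)"
  proof -
    have "distr M (Pi\<^sub>M {0} (\<lambda>_. borel)) (\<lambda>\<omega>. \<lambda>k\<in>{0}. X (k + (n - 1) + 1) \<omega>) =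
        distr M (Pi\<^sub>M {0} (\<lambda>_. borel)) (\<lambda>\<omega>. \<lambda>k\<in>{0}. X (k + 1) \<omega>)"
      using assms(6) unfolding strictly_stationary_def by blast
    from arg_cong[OF this, of "\<lambda>N. distr N borel (\<lambda>f. f 0)"]
    show ?thesis
      using \<open>n \<ge> 1\<close> by (simp add: distr_distr comp_def)
  qed
  \<comment> \<open>The copula is given at time \<open>n\<close>, but the factorisation of the events needs it at time \<open>1\<close>.\<close>
  have C1: "C a b = \<P>(\<omega> in M. margin F j (X 1 \<omega> $ j) \<le> a \<and> margin F j' (X 1 \<omega> $ j') \<le> b)" for a b
  proof -
    let ?S = "{x :: real ^ 'd. margin F j (x $ j) \<le> a \<and> margin F j' (x $ j') \<le> b}"
    have [measurable]: "?S \<in> sets borel" by measurable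
    have "measure (distr M borel (X n)) ?S = measure (distr M borel (X 1)) ?S"
      by (simp add: distr_n)
    then show ?thesis
      by (simp add: measure_distr vimage_def Int_def conj_commute C_def pair_copula_def)
  qed

  have q_pos: "q t > 0" and tail: "tail_cond_prob M F X r j j' t = 2 - L t"
    and C_lower: "q t - t \<le> C (1 - t) (q t)" and C_upper: "C (1 - t) (q t) \<le> 1 - t"
    if t: "0 < t" "t < 1" for t
  proof -
    define v where "v = c j' powi (- int r) * w t"
    have scale: "c j' ^ r * x \<le> w t \<longleftrightarrow> x \<le> v" for x
      using pos[of j'] by (simp add: v_def power_int_minus field_simps)
    have Fw: "margin F j' (w t) = 1 - t" using t by (simp add: w_def marg_inv)
    have Fv: "margin F j' v = q t" by (simp add: q_def v_def)
    define H where "H = \<P>(\<omega> in M. \<forall>k\<in>{1..r}. c j' ^ (r - k) * Y (1 + k) \<omega> $ j' \<le> w t)"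
    have split: "\<P>(\<omega> in M. X 1 \<omega> \<in> A \<and> X (1 + r) \<omega> $ j' \<le> w t) =
        \<P>(\<omega> in M. X 1 \<omega> \<in> A \<and> X 1 \<omega> $ j' \<le> v) * H" if "A \<in> sets borel" for A
      using prob_max_autoregression_split[OF pos indep rec that, where i = j' and r = r and u = "w t"]
      by (simp add: H_def scale)
    have "1 - t = q t * H"
      using split[of UNIV] Fw Fv margin_eq[of "1 + r" j' "w t"] margin_eq[of 1 j' v] by simp
    \<comment> \<open>Monotonicity of the margin would not give \<open>q t > 0\<close>: for negative \<open>w t\<close> the point \<open>v\<close> may lie
      below \<open>w t\<close>. The factorisation does.\<close>
    moreover have "q t \<ge> 0" using margin_eq[of 1 j' v] Fv by simp
    ultimately show qp: "q t > 0"
      using t by (metis diff_gt_0_iff_gt mult_zero_left order_le_less)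
    have H: "H = (1 - t) / q t"
      using \<open>1 - t = q t * H\<close> qp by (simp add: field_simps)

    let ?a = "\<lambda>\<omega>. margin F j (X 1 \<omega> $ j) \<le> 1 - t"
    let ?b = "\<lambda>\<omega>. margin F j' (X (1 + r) \<omega> $ j') \<le> 1 - t"
    have pa: "\<P>(\<omega> in M. ?a \<omega>) = 1 - t" and pb: "\<P>(\<omega> in M. ?b \<omega>) = 1 - t"
      using t by (simp_all add: unif)
    have "\<P>(\<omega> in M. ?a \<omega> \<and> ?b \<omega>) = \<P>(\<omega> in M. ?a \<omega> \<and> X (1 + r) \<omega> $ j' \<le> w t)"
      using AE_le[of "1 + r" j' "w t"] by (intro prob_eq_AE) (auto simp: Fw)
    also have "\<dots> = \<P>(\<omega> in M. ?a \<omega> \<and> X 1 \<omega> $ j' \<le> v) * H"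
      using split[of "{x. margin F j (x $ j) \<le> 1 - t}"] by simp
    also have "\<P>(\<omega> in M. ?a \<omega> \<and> X 1 \<omega> $ j' \<le> v) = C (1 - t) (q t)"
      unfolding C1 using AE_le[of 1 j' v] by (intro prob_eq_AE) (auto simp: Fv)
    finally have pab: "\<P>(\<omega> in M. ?a \<omega> \<and> ?b \<omega>) = C (1 - t) (q t) * ((1 - t) / q t)"
      by (simp add: H)

    have incl_excl: "\<P>(\<omega> in M. \<not> P \<omega> \<and> \<not> Q \<omega>) =
        1 - \<P>(\<omega> in M. P \<omega>) - \<P>(\<omega> in M. Q \<omega>) + \<P>(\<omega> in M. P \<omega> \<and> Q \<omega>)"
      if [measurable]: "{\<omega> \<in> space M. P \<omega>} \<in> events" "{\<omega> \<in> space M. Q \<omega>} \<in> events" for P Q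
    proof -
      have "{\<omega> \<in> space M. \<not> P \<omega> \<and> \<not> Q \<omega>} =
          space M - ({\<omega> \<in> space M. P \<omega>} \<union> {\<omega> \<in> space M. Q \<omega>})" by blast
      moreover have "{\<omega> \<in> space M. P \<omega> \<and> Q \<omega>} =
          {\<omega> \<in> space M. P \<omega>} \<inter> {\<omega> \<in> space M. Q \<omega>}" by blast
      ultimately show ?thesis
        using that by (simp add: prob_compl measure_Un3 fmeasurable_eq_sets)
    qed
    have "tail_cond_prob M F X r j j' t =
        \<P>(\<omega> in M. \<not> ?b \<omega> \<and> \<not> ?a \<omega>) / \<P>(\<omega> in M. \<not> ?a \<omega>)"
      by (simp add: tail_cond_prob_def cond_prob_def not_le)
    also have "\<P>(\<omega> in M. \<not> ?a \<omega>) = t"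
      using pa by (subst prob_neg) simp_all
    also have "\<P>(\<omega> in M. \<not> ?b \<omega> \<and> \<not> ?a \<omega>) = 2 * t - 1 + C (1 - t) (q t) * ((1 - t) / q t)"
      using incl_excl[of ?b ?a] pa pb pab by (simp add: conj_commute)
    finally show "tail_cond_prob M F X r j j' t = 2 - L t"
      using t by (simp add: L_def field_simps)

    \<comment> \<open>By inclusion and exclusion, \<open>C (1 - t) (q t) - ((1 - t) + q t - 1)\<close> is the probability that
      both inequalities fail.\<close>
    let ?d = "\<lambda>\<omega>. X 1 \<omega> $ j' \<le> v"
    have pd: "\<P>(\<omega> in M. ?d \<omega>) = q t"
      using margin_eq[of 1 j' v] Fv by simp
    have C_eq: "C (1 - t) (q t) = \<P>(\<omega> in M. ?a \<omega> \<and> ?d \<omega>)"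
      unfolding C1 using AE_le[of 1 j' v] by (intro prob_eq_AE) (auto simp: Fv)
    show "C (1 - t) (q t) \<le> 1 - t"
      using finite_measure_mono[of "{\<omega> \<in> space M. ?a \<omega> \<and> ?d \<omega>}" "{\<omega> \<in> space M. ?a \<omega>}"] pa
      by (auto simp: C_eq)
    show "q t - t \<le> C (1 - t) (q t)"
      using incl_excl[of ?a ?d] measure_nonneg[of M "{\<omega> \<in> space M. \<not> ?a \<omega> \<and> \<not> ?d \<omega>}"] pa pd
      unfolding C_eq by simp
  qed

  have bounds: "1 - (1 - t) / q t \<le> 2 - L t" "2 - L t \<le> 2 - 1 / t * (1 - (1 - t)\<^sup>2 / q t)"
    if t: "0 < t" "t < 1" for t
  proof -
    define h where "h = (1 - t) / q t"
    have h: "h \<ge> 0" "q t * h = 1 - t"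
      using t q_pos[OF t] by (simp_all add: h_def)
    have L: "L t = (1 - C (1 - t) (q t) * h) / t"
      by (simp add: L_def h_def)
    have "(q t - t) * h \<le> C (1 - t) (q t) * h"
      using C_lower[OF t] h(1) by (rule mult_right_mono)
    moreover have "(q t - t) * h = 1 - t * (1 + h)"
      using h(2) by (simp add: left_diff_distrib distrib_left)
    ultimately have "1 - C (1 - t) (q t) * h \<le> t * (1 + h)"
      by linarith
    then have "L t \<le> 1 + h"
      using t(1) by (simp add: L pos_divide_le_eq mult.commute)
    then show "1 - (1 - t) / q t \<le> 2 - L t" by (simp add: h_def)
    have "C (1 - t) (q t) * h \<le> (1 - t) * h"
      using C_upper[OF t] h(1) by (rule mult_right_mono)
    also have "(1 - t) * h = (1 - t)\<^sup>2 / q t"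
      by (simp add: h_def power2_eq_square)
    finally show "2 - L t \<le> 2 - 1 / t * (1 - (1 - t)\<^sup>2 / q t)"
      using t(1) by (simp add: L divide_right_mono)
  qed

  have ev: "eventually (\<lambda>t. tail_cond_prob M F X r j j' t = 2 - L t) (at_right 0)"
    using tail by (auto simp: eventually_at_right_field intro!: exI[of _ 1])
  have tail_iff: "(tail_cond_prob M F X r j j' \<longlongrightarrow> l) (at_right 0) \<longleftrightarrow> (L \<longlongrightarrow> 2 - l) (at_right 0)" for l
  proof -
    have "(tail_cond_prob M F X r j j' \<longlongrightarrow> l) (at_right 0) \<longleftrightarrow> ((\<lambda>t. 2 - L t) \<longlongrightarrow> l) (at_right 0)"
      by (rule tendsto_cong[OF ev])
    also have "\<dots> \<longleftrightarrow> (L \<longlongrightarrow> 2 - l) (at_right 0)"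
      using tendsto_diff[OF tendsto_const[of 2], of "\<lambda>t. 2 - L t" l "at_right 0"]
        tendsto_diff[OF tendsto_const[of 2], of L "2 - l" "at_right 0"] by auto
    finally show ?thesis .
  qed
  have ex: "lag_tail_dep_exists M F X r j j' \<longleftrightarrow> (\<exists>l. (L \<longlongrightarrow> l) (at_right 0))"
  proof
    assume "\<exists>l. (L \<longlongrightarrow> l) (at_right 0)"
    then obtain l where "(L \<longlongrightarrow> 2 - (2 - l)) (at_right 0)" by auto
    then show "lag_tail_dep_exists M F X r j j'"
      unfolding lag_tail_dep_exists_def tail_iff by blast
  qed (auto simp: lag_tail_dep_exists_def tail_iff)
  have lim: "lag_tail_dep M F X r j j' = 2 - Lim (at_right 0) L"
    if "lag_tail_dep_exists M F X r j j'"
  proof -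
    obtain l where l: "(tail_cond_prob M F X r j j' \<longlongrightarrow> l) (at_right 0)"
      using \<open>lag_tail_dep_exists M F X r j j'\<close> by (auto simp: lag_tail_dep_exists_def)
    then have "lag_tail_dep M F X r j j' = l" "Lim (at_right 0) L = 2 - l"
      using tail_iff by (auto simp: lag_tail_dep_def intro!: tendsto_Lim)
    then show ?thesis by simp
  qed
  show ?thesis
    unfolding Let_def w_def[symmetric] q_def[symmetric] C_def[symmetric] L_def[symmetric]
    using ex lim bounds by blast
qed

end
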